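(* For every $T$-round DRACC instance in which every user has a $k_t$-demand valuation function, the corresponding Dd-MDP is $O(\sqrt{C W\cdot T})$-chasable (with respect to arbitrary target pricing policies).
   Context: DRACC problem: there are $N$ resources and $T$ users arriving in rounds $t=1,\dots,T$. Resource $i\in[N]$ arrives at the start of round $t_a(i)$ and departs at the end of round $t_e(i)$ ($1\le t_a(i)\le t_e(i)\le T$), with capacity $c(i)\in\mathbb{Z}_{>0}$ units on arrival. $A_t\subseteq[N]$ is the set of resources active at time $t$ (those with $t_a(i)\le t\le t_e(i)$). $C\ge\max_i c(i)$ and $W\ge\max_t|A_t|$ are known upper bounds independent of $T$. User $t$ has a valuation $v_t:2^{A_t}\to[0,1)$ with $v_t(\emptyset)=0$ and is quasi-linear. A valuation is $k_t$-demand if there are an integer $1\le k_t\le|A_t|$ and values $w_t^i\in[0,1)$ such that $v_t(A)=\max_{A'\subseteq A,|A'|\le k_t}\sum_{i\in A'}w^i_t$. In round $t$ a mechanism posts $\bm p_t\in(0,1]^{A_t}$; user $t$ receives one unit of each resource in the demand set $\hat A^{\bm p}_t=\arg\max_{A\subseteq A_t}\{v_t(A)-\sum_{i\in A}\bm p(i)\}$ (ties broken lexicographically) and pays $\hat q^{\bm p}_t=\sum_{i\in\hat A^{\bm p}_t}\bm p(i)$; $v_t$ is revealed to the mechanism after posting. The inventory vector $\bm\lambda_t\in\{0,\dots,C\}^{A_t}$ has $\bm\lambda_t(i)=c(i)$ if $t_a(i)=t$, and $\bm\lambda_{t+1}(i)=\bm\lambda_t(i)-\mathbb{1}[i\in\hat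 A^{\bm p_t}_t]$ for $i\in A_t\cap A_{t+1}$. A price vector $\bm p$ is feasible for $\bm\lambda$ if $\bm p(i)=1$ whenever $\bm\lambda(i)=0$; posted prices must be feasible. A pricing policy maps each inventory vector to a feasible price vector. Arrival/departure times, capacities and valuations are chosen by an (adaptive) adversary. Corresponding Dd-MDP: states are inventory vectors; feasible actions at a state are price vectors feasible for it; reward $f_t(s,x)=\hat q^{x}_t$; transition $g_t(s,x)=s'$ with $s'(i)=s(i)-\mathbb{1}[i\in\hat A^x_t]$ for $i\in A_{t+1}\cap A_t$ and $s'(i)=c(i)$ for $i\in A_{t+1}\setminus A_t$. A policy $\gamma$ is simulated from the true initial inventory: $s^\gamma_1=s_1$, $x^\gamma_t=\gamma(s^\gamma_t)$, $s^\gamma_{t+1}=g_t(s^\gamma_t,x^\gamma_t)$. $\sigma$-chasability: there is a (possibly randomized) chasing oracle such that for any target policy $\gamma$, any round $t_{\mathrm{init}}$ and any initial state $s_{\mathrm{init}}$ (possibly different from $s^\gamma_{t_{\mathrm{init}}}$), it outputs in each round $t\ge t_{\mathrm{init}}$ an action $\hat x(t)$ feasible for $\hat s(t)$, where $\hat s(t_{\mathrm{init}})=s_{\mathrm{init}}$, $\hat s(t)=g_{t-1}(\hat s(t-1),\hat x(t-1))$, and afterwards observes $g_t,f_t$; and for every $t_{\mathrm{final}}\ge t_{\mathrm{init}}$, $\sum_{t=t_{\mathrm{init}}}^{t_{\mathrm{final}}}f_t(s^\gamma_t,x^\gamma_t)-\sum_{t=t_{\mathrm{init}}}^{t_{\mathrm{final}}}\mathbb{E}[f_t(\hat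 s(t),\hat x(t))]\le\sigma$. *)

theory Defs
  imports "HOL-Probability.Probability" "HOL-Library.List_Lexorder"
begin

text \<open>Resources are natural numbers; an instance consists of the (finite) resource set [N],
 arrival and departure rounds, capacities and the users' valuations (user t has valuation val t).\<close>

record inst =
  res :: "nat set"
  ta  :: "nat \<Rightarrow> nat"
  te  :: "nat \<Rightarrow> nat"
  cap :: "nat \<Rightarrow> nat"
  val :: "nat \<Rightarrow> nat set \<Rightarrow> real"

type_synonym price = "nat \<Rightarrow> real"
type_synonym state = "nat \<Rightarrow> nat option"   \<comment> \<open>inventory vector, domain = active set\<close>

definition active :: "inst \<Rightarrow> nat \<Rightarrow> nat set" where
  "active I t = {i \<in> res I. ta I i \<le> t \<and> t \<le> te I i}"

definition valuation_on :: "nat set \<Rightarrow> (nat set \<Rightarrow> real) \<Rightarrow> bool" where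
  "valuation_on A v \<longleftrightarrow> v {} = 0 \<and> (\<forall>B. B \<subseteq> A \<longrightarrow> 0 \<le> v B \<and> v B < 1)"

definition k_demand :: "nat set \<Rightarrow> (nat set \<Rightarrow> real) \<Rightarrow> bool" where
  "k_demand A v \<longleftrightarrow> (\<exists>(k::nat) (w::nat \<Rightarrow> real). 1 \<le> k \<and> k \<le> card A \<and>
      (\<forall>i\<in>A. 0 \<le> w i \<and> w i < 1) \<and>
      (\<forall>B. B \<subseteq> A \<longrightarrow> v B = Max {sum w B' | B'. B' \<subseteq> B \<and> card B' \<le> k}))"

definition dracc_instance :: "nat \<Rightarrow> nat \<Rightarrow> nat \<Rightarrow> inst \<Rightarrow> bool" where
  "dracc_instance C W T I \<longleftrightarrow> finite (res I) \<and>
     (\<forall>i\<in>res I. 1 \<le> ta I i \<and> ta I i \<le> te I i \<and> te I i \<le> T \<and> 0 < cap I i \<and> cap I i \<le> C) \<and>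
     (\<forall>t\<in>{1..T}. card (active I t) \<le> W \<and> valuation_on (active I t) (val I t))"

definition k_demand_instance :: "nat \<Rightarrow> inst \<Rightarrow> bool" where
  "k_demand_instance T I \<longleftrightarrow> (\<forall>t\<in>{1..T}. k_demand (active I t) (val I t))"

text \<open>Demand set: maximiser of quasi-linear utility over subsets of the active set; ties broken
 by taking the lexicographically least sorted list of resource indices.\<close>
definition demand_set :: "inst \<Rightarrow> nat \<Rightarrow> price \<Rightarrow> nat set" where
  "demand_set I t p =
     (let A = active I t;
          U = (\<lambda>B. val I t B - sum p B);
          M = {B. B \<subseteq> A \<and> (\<forall>B'. B' \<subseteq> A \<longrightarrow> U B' \<le> U B)}
      in set (Min (sorted_list_of_set ` M)))"

definition reward :: "inst \<Rightarrow> nat \<Rightarrow> price \<Rightarrow> real" where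
  "reward I t p = sum p (demand_set I t p)"

definition trans :: "inst \<Rightarrow> nat \<Rightarrow> state \<Rightarrow> price \<Rightarrow> state" where
  "trans I t s p = (\<lambda>i. if i \<in> active I (Suc t) then
       (if i \<in> active I t then map_option (\<lambda>n. n - (if i \<in> demand_set I t p then 1 else 0)) (s i)
        else Some (cap I i))
     else None)"

definition feasible :: "state \<Rightarrow> price \<Rightarrow> bool" where
  "feasible s p \<longleftrightarrow> (\<forall>i\<in>dom s. 0 < p i \<and> p i \<le> 1 \<and> (s i = Some 0 \<longrightarrow> p i = 1))"

definition inventory_vector :: "nat \<Rightarrow> state \<Rightarrow> bool" where
  "inventory_vector C s \<longleftrightarrow> finite (dom s) \<and> (\<forall>i n. s i = Some n \<longrightarrow> n \<le> C)"

definition pricing_policy :: "nat \<Rightarrow> (state \<Rightarrow> price) \<Rightarrow> bool" where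
  "pricing_policy C \<gamma> \<longleftrightarrow> (\<forall>s. inventory_vector C s \<longrightarrow> feasible s (\<gamma> s))"

definition init_state :: "inst \<Rightarrow> state" where
  "init_state I = (\<lambda>i. if i \<in> active I 1 then Some (cap I i) else None)"

text \<open>pol_st I g n = state of the target policy at round n+1 (simulated from the true initial inventory).\<close>
primrec pol_st :: "inst \<Rightarrow> (state \<Rightarrow> price) \<Rightarrow> nat \<Rightarrow> state" where
  "pol_st I \<gamma> 0 = init_state I"
| "pol_st I \<gamma> (Suc n) = trans I (Suc n) (pol_st I \<gamma> n) (\<gamma> (pol_st I \<gamma> n))"

definition policy_state :: "inst \<Rightarrow> (state \<Rightarrow> price) \<Rightarrow> nat \<Rightarrow> state" where
  "policy_state I \<gamma> t = pol_st I \<gamma> (t - 1)"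

type_synonym rinfo = "nat set \<times> (nat \<Rightarrow> nat) \<times> (nat set \<Rightarrow> real)"
type_synonym observation = "(nat \<Rightarrow> rinfo option) \<times> nat set \<times> (nat \<Rightarrow> nat)"

definition rinfo :: "inst \<Rightarrow> nat \<Rightarrow> rinfo" where
  "rinfo I s = (active I s, (\<lambda>i. if i \<in> active I s then cap I i else 0),
                (\<lambda>B. if B \<subseteq> active I s then val I s B else 0))"

definition view :: "inst \<Rightarrow> nat \<Rightarrow> nat \<Rightarrow> rinfo option" where
  "view I t = (\<lambda>s. if s \<le> t then Some (rinfo I s) else None)"

text \<open>What the oracle knows when posting in round t: all data of earlier rounds, and the
 active resources of round t with their capacities (the valuation v_t is revealed only after posting).\<close>
definition obs :: "inst \<Rightarrow> nat \<Rightarrow> observation" where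
  "obs I t = ((\<lambda>s. if s < t then Some (rinfo I s) else None), active I t,
              (\<lambda>i. if i \<in> active I t then cap I i else 0))"

text \<open>An adaptive adversary maps the oracle's action sequence to an instance; the data of rounds
 up to t may only depend on the oracle's actions in rounds before t.\<close>
definition causal_adversary :: "((nat \<Rightarrow> price) \<Rightarrow> inst) \<Rightarrow> bool" where
  "causal_adversary adv \<longleftrightarrow>
     (\<forall>xs ys t. (\<forall>s<t. xs s = ys s) \<longrightarrow> view (adv xs) t = view (adv ys) t)"

definition dflt :: price where "dflt = (\<lambda>_. 1)"

primrec act_pre :: "(nat \<Rightarrow> observation \<Rightarrow> price) \<Rightarrow> ((nat \<Rightarrow> price) \<Rightarrow> inst) \<Rightarrow> nat \<Rightarrow> nat \<Rightarrow> (nat \<Rightarrow> price)" where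
  "act_pre orc adv t0 0 = (\<lambda>_. dflt)"
| "act_pre orc adv t0 (Suc t) = (act_pre orc adv t0 t)
     (t := (if t < t0 then dflt else orc t (obs (adv (act_pre orc adv t0 t)) t)))"

definition actions :: "(nat \<Rightarrow> observation \<Rightarrow> price) \<Rightarrow> ((nat \<Rightarrow> price) \<Rightarrow> inst) \<Rightarrow> nat \<Rightarrow> nat \<Rightarrow> (nat \<Rightarrow> price)" where
  "actions orc adv t0 T = act_pre orc adv t0 (Suc T)"

primrec orc_st :: "inst \<Rightarrow> (nat \<Rightarrow> price) \<Rightarrow> nat \<Rightarrow> state \<Rightarrow> nat \<Rightarrow> state" where
  "orc_st I xs t0 s0 0 = s0"
| "orc_st I xs t0 s0 (Suc n) = trans I (t0 + n) (orc_st I xs t0 s0 n) (xs (t0 + n))"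

definition oracle_state :: "inst \<Rightarrow> (nat \<Rightarrow> price) \<Rightarrow> nat \<Rightarrow> state \<Rightarrow> nat \<Rightarrow> state" where
  "oracle_state I xs t0 s0 t = orc_st I xs t0 s0 (t - t0)"

definition admissible_adversary ::
  "nat \<Rightarrow> nat \<Rightarrow> nat \<Rightarrow> nat \<Rightarrow> state \<Rightarrow> ((nat \<Rightarrow> price) \<Rightarrow> inst) \<Rightarrow> bool" where
  "admissible_adversary C W T t0 s0 adv \<longleftrightarrow> causal_adversary adv \<and>
     (\<forall>xs. dracc_instance C W T (adv xs) \<and> k_demand_instance T (adv xs)) \<and>
     active (adv (\<lambda>_. dflt)) t0 = dom s0"

definition chase_gap ::
  "(nat \<Rightarrow> observation \<Rightarrow> price) \<Rightarrow> ((nat \<Rightarrow> price) \<Rightarrow> inst) \<Rightarrow> (state \<Rightarrow> price) \<Rightarrow> nat \<Rightarrow> state \<Rightarrow> nat \<Rightarrow> nat \<Rightarrow> real" where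
  "chase_gap orc adv \<gamma> t0 s0 T tf =
     (let xs = actions orc adv t0 T; I = adv xs in
      (\<Sum>t\<in>{t0..tf}. reward I t (\<gamma> (policy_state I \<gamma> t))) - (\<Sum>t\<in>{t0..tf}. reward I t (xs t)))"

definition oracle_feasible ::
  "(nat \<Rightarrow> observation \<Rightarrow> price) \<Rightarrow> ((nat \<Rightarrow> price) \<Rightarrow> inst) \<Rightarrow> nat \<Rightarrow> state \<Rightarrow> nat \<Rightarrow> bool" where
  "oracle_feasible orc adv t0 s0 T =
     (let xs = actions orc adv t0 T; I = adv xs in
      \<forall>t\<in>{t0..T}. feasible (oracle_state I xs t0 s0 t) (xs t))"

text \<open>sigma-chasability of the Dd-MDP of T-round DRACC instances with k-demand users
 (bounds C, W): a randomized oracle, given as a discrete distribution mu over seeds together with a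
 deterministic strategy per seed, which may depend on the target policy, t0 and s0.\<close>
definition kdemand_chasable :: "nat \<Rightarrow> nat \<Rightarrow> nat \<Rightarrow> real \<Rightarrow> bool" where
  "kdemand_chasable C W T \<sigma> \<longleftrightarrow>
    (\<forall>\<gamma> t0 s0. pricing_policy C \<gamma> \<and> 1 \<le> t0 \<and> t0 \<le> T \<and> inventory_vector C s0 \<longrightarrow>
      (\<exists>(\<mu>::nat pmf) (orc::nat \<Rightarrow> nat \<Rightarrow> observation \<Rightarrow> price).
        \<forall>adv. admissible_adversary C W T t0 s0 adv \<longrightarrow>
          (\<forall>\<omega>\<in>set_pmf \<mu>. oracle_feasible (orc \<omega>) adv t0 s0 T) \<and>
          (\<forall>tf\<in>{t0..T}.
             integrable (measure_pmf \<mu>) (\<lambda>\<omega>. chase_gap (orc \<omega>) adv \<gamma> t0 s0 T tf) \<and>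
             measure_pmf.expectation \<mu> (\<lambda>\<omega>. chase_gap (orc \<omega>) adv \<gamma> t0 s0 T tf) \<le> \<sigma>)))"

end

theory Submission
  imports Defs
begin

text \<open>
  The oracle simulates the target policy. In every round it explores with probability \<open>\<epsilon>\<close>, posting
  price 1 everywhere so that nothing is sold, and otherwise posts the target's prices, raised to 1 on
  the set \<open>M\<close> of resources of which it owns fewer units than the target. Let \<open>D\<close> and \<open>D'\<close> be the
  bundles sold by the target and by an exploiting oracle. Since \<open>k\<close>-demand users regard resources as
  substitutes, \<open>card (D' - D) \<le> card (D \<inter> M)\<close>. Hence the deficit, the number of units the target owns in
  excess of the oracle summed over resources, never grows in exploiting rounds, in which the
  oracle loses at most \<open>card (D \<inter> M)\<close>; in an exploring round it loses at most 1 while the deficit shrinks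
  by \<open>card (D \<inter> M)\<close>. So the cumulative loss plus the deficit divided by \<open>\<epsilon>\<close> rises by at most \<open>\<epsilon>\<close> per round in
  expectation, which gives the bound \<open>C W / \<epsilon> + \<epsilon> T\<close>, to be optimised over \<open>\<epsilon>\<close>.
\<close>

section \<open>Lexicographic comparison of sorted lists of sets\<close>

lemma append_less_append:
  fixes xs :: "'a::linorder list"
  shows "ys < zs \<Longrightarrow> xs @ ys < xs @ zs"
  by (induction xs) auto

lemma sorted_list_of_set_split:
  fixes S :: "'a::linorder set"
  assumes "finite S"
  shows "sorted_list_of_set S =
    sorted_list_of_set {x\<in>S. x < j} @ sorted_list_of_set {x\<in>S. j \<le> x}"
proof (rule sorted_distinct_set_unique)
  show "sorted (sorted_list_of_set {x\<in>S. x < j} @ sorted_list_of_set {x\<in>S. j \<le> x})"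
    using assms by (force simp: sorted_append)
  show "distinct (sorted_list_of_set {x\<in>S. x < j} @ sorted_list_of_set {x\<in>S. j \<le> x})"
    using assms by (auto simp: distinct_append)
qed (use assms in auto)

text \<open>The lists share the block of elements below \<open>j\<close>. The next entry is
  \<open>j\<close> for \<open>S\<close>; for \<open>T\<close> it exceeds \<open>j\<close>, and it
  exists because of \<open>e\<close>. Without such an \<open>e\<close> the list of \<open>T\<close>
  would be a proper prefix, hence smaller.\<close>

lemma sorted_list_of_set_less:
  fixes S T :: "'a::linorder set"
  assumes fin: "finite S" "finite T" and same: "{x\<in>S. x < j} = {x\<in>T. x < j}"
    and j: "j \<in> S" "j \<notin> T" and e: "e \<in> T" "j < e"
  shows "sorted_list_of_set S < sorted_list_of_set T"
proof -
  let ?S = "{x\<in>S. j \<le> x}" and ?T = "{x\<in>T. j \<le> x}"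
  have "sorted_list_of_set ?S = j # sorted_list_of_set (?S - {j})"
  proof -
    have "Min ?S = j"
      using fin j by (intro Min_eqI) auto
    then show ?thesis
      using fin j by (subst sorted_list_of_set_nonempty) auto
  qed
  moreover have "sorted_list_of_set ?T = Min ?T # sorted_list_of_set (?T - {Min ?T})"
    using fin e by (subst sorted_list_of_set_nonempty) auto
  moreover have "j < Min ?T"
    using fin j e by (subst Min_gr_iff) (auto simp: order.order_iff_strict)
  ultimately have "sorted_list_of_set ?S < sorted_list_of_set ?T"
    by simp
  then show ?thesis
    by (simp add: sorted_list_of_set_split[OF fin(1), of j] sorted_list_of_set_split[OF fin(2), of j]
        same append_less_append)
qed

text \<open>The opposite tie break: appending a new maximum turns the old list into a proper prefix,
  so a zero-surplus item above all others is left out of the bundle.\<close>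

lemma sorted_list_of_set_less_insert:
  fixes S :: "'a::linorder set"
  assumes "finite S" "\<And>x. x \<in> S \<Longrightarrow> x < j"
  shows "sorted_list_of_set S < sorted_list_of_set (insert j S)"
proof -
  have "{x \<in> insert j S. x < j} = S" "{x \<in> insert j S. j \<le> x} = {j}"
    using assms(2) by force+
  then have "sorted_list_of_set (insert j S) = sorted_list_of_set S @ [j]"
    using sorted_list_of_set_split[of "insert j S" j] assms(1) by simp
  then show ?thesis
    using append_less_append[of "[]" "[j]" "sorted_list_of_set S"] by simp
qed

lemma card_exchange:
  assumes "finite S" "y \<in> S" "j \<notin> S"
  shows "card (insert j (S - {y})) = card S"
  using assms card_Suc_Diff1[of S y] by simp

section \<open>Demand sets of k-demand users\<close>

definition optimal_bundles :: "inst \<Rightarrow> nat \<Rightarrow> price \<Rightarrow> nat set set" where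
  "optimal_bundles I t p = {B. B \<subseteq> active I t \<and>
     (\<forall>B'. B' \<subseteq> active I t \<longrightarrow> val I t B' - sum p B' \<le> val I t B - sum p B)}"

lemma optimal_bundlesD:
  assumes "B \<in> optimal_bundles I t p"
  shows "B \<subseteq> active I t" "B' \<subseteq> active I t \<Longrightarrow> val I t B' - sum p B' \<le> val I t B - sum p B"
  using assms by (auto simp: optimal_bundles_def)

text \<open>The least list lies in the image of the set of maximisers, which is finite and, as there
  are only finitely many bundles, nonempty. This separates utility maximisation from tie
  breaking.\<close>

lemma
  assumes fin: "finite (active I t)"
  shows demand_set_optimal: "demand_set I t p \<in> optimal_bundles I t p"
    and demand_set_least: "B \<in> optimal_bundles I t p \<Longrightarrow>
      sorted_list_of_set (demand_set I t p) \<le> sorted_list_of_set B"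
proof -
  let ?M = "optimal_bundles I t p" and ?U = "\<lambda>B. val I t B - sum p B"
  let ?m = "Min (sorted_list_of_set ` ?M)"
  have D: "demand_set I t p = set ?m"
    unfolding demand_set_def optimal_bundles_def Let_def ..
  have finM: "finite ?M"
    by (rule finite_subset[of _ "Pow (active I t)"]) (use fin in \<open>auto simp: optimal_bundles_def\<close>)
  have "finite (?U ` Pow (active I t))" "?U ` Pow (active I t) \<noteq> {}"
    using fin by auto
  then have "Max (?U ` Pow (active I t)) \<in> ?U ` Pow (active I t)"
    by (rule Max_in)
  then obtain B0 where B0: "B0 \<subseteq> active I t" "?U B0 = Max (?U ` Pow (active I t))"
    by auto
  have "B0 \<in> ?M"
    unfolding optimal_bundles_def using B0 fin by auto
  then have "?m \<in> sorted_list_of_set ` ?M"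
    using finM by (intro Min_in) auto
  then obtain B1 where B1: "B1 \<in> ?M" "?m = sorted_list_of_set B1"
    by auto
  have "finite B1"
    using optimal_bundlesD(1)[OF B1(1)] fin by (rule finite_subset)
  then have "demand_set I t p = B1"
    using B1 D by simp
  then show "demand_set I t p \<in> ?M"
    using B1(1) by simp_all
  show "sorted_list_of_set (demand_set I t p) \<le> sorted_list_of_set B" if "B \<in> ?M"
    using B1(2) \<open>demand_set I t p = B1\<close> finM that by (metis Min_le finite_imageI image_eqI)
qed

locale k_demand_user =
  fixes I :: inst and t k :: nat and w :: "nat \<Rightarrow> real"
  assumes fin: "finite (active I t)"
    and w: "i \<in> active I t \<Longrightarrow> 0 \<le> w i" "i \<in> active I t \<Longrightarrow> w i < 1"
    and val_lt_1: "B \<subseteq> active I t \<Longrightarrow> val I t B < 1"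
    and val_Max: "B \<subseteq> active I t \<Longrightarrow>
      val I t B = Max {sum w B' | B'. B' \<subseteq> B \<and> card B' \<le> k}"
begin

lemma val_obtain:
  assumes "B \<subseteq> active I t"
  obtains B' where "B' \<subseteq> B" "card B' \<le> k" "val I t B = sum w B'"
proof -
  let ?X = "{sum w B' | B'. B' \<subseteq> B \<and> card B' \<le> k}"
  have "finite B"
    using assms fin finite_subset by blast
  then have "finite ?X"
    by (auto intro: finite_subset[of _ "sum w ` Pow B"])
  moreover have "?X \<noteq> {}"
    by (auto intro!: exI[of _ "{}"])
  ultimately have "Max ?X \<in> ?X"
    by (rule Max_in)
  then show ?thesis
    using that val_Max[OF assms] by auto
qed

text \<open>The weights are nonnegative, so among its own subsets a bundle of at most
  \<open>k\<close> items is a maximiser itself.\<close>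

lemma val_eq_sum:
  assumes "B \<subseteq> active I t" "card B \<le> k"
  shows "val I t B = sum w B"
proof -
  have "finite B"
    using assms fin finite_subset by blast
  have "Max {sum w B' | B'. B' \<subseteq> B \<and> card B' \<le> k} = sum w B"
  proof (rule Max_eqI)
    show "finite {sum w B' | B'. B' \<subseteq> B \<and> card B' \<le> k}"
      by (rule finite_subset[of _ "sum w ` Pow B"]) (use \<open>finite B\<close> in auto)
    show "y \<le> sum w B" if "y \<in> {sum w B' | B'. B' \<subseteq> B \<and> card B' \<le> k}" for y
      using that assms w(1) \<open>finite B\<close> by (auto intro!: sum_mono2)
    show "sum w B \<in> {sum w B' | B'. B' \<subseteq> B \<and> card B' \<le> k}"
      using assms by auto
  qed
  then show ?thesis
    using val_Max[OF assms(1)] by simp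
qed

text \<open>Items outside a subset \<open>B'\<close> that realises the value only cost money:
  optimality forces the total price of \<open>B - B'\<close> to be at most 0, but prices are
  positive.\<close>

lemma optimal_card_le:
  assumes "B \<in> optimal_bundles I t p" and "\<And>i. i \<in> active I t \<Longrightarrow> 0 < p i"
  shows "card B \<le> k"
proof -
  note B = optimal_bundlesD[OF assms(1)]
  obtain B' where B': "B' \<subseteq> B" "card B' \<le> k" "val I t B = sum w B'"
    using val_obtain[OF B(1)] .
  have finB: "finite B"
    using B(1) fin finite_subset by blast
  have "val I t B' = sum w B'"
    using B' B(1) by (intro val_eq_sum) auto
  then have "sum p B \<le> sum p B'"
    using B(2)[of B'] B' B(1) by auto
  moreover have "sum p B = sum p B' + sum p (B - B')"
    using sum.subset_diff[OF B'(1) finB, of p] by simp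
  ultimately have "\<not> 0 < sum p (B - B')"
    by simp
  then have "B - B' = {}"
    using sum_pos[of "B - B'" p] finB B(1) assms(2) by blast
  then show ?thesis
    using B' by (metis Diff_eq_empty_iff subset_antisym)
qed

lemma optimal_surplus_nonneg:
  assumes opt: "B \<in> optimal_bundles I t p" and p: "\<And>i. i \<in> active I t \<Longrightarrow> 0 < p i"
    and i: "i \<in> B"
  shows "p i \<le> w i"
proof -
  note B = optimal_bundlesD[OF opt]
  have finB: "finite B"
    using B(1) fin finite_subset by blast
  have c: "card B \<le> k"
    using optimal_card_le[OF opt p] .
  then have "card (B - {i}) \<le> k"
    using finB card_Diff1_le[of B i] by linarith
  then have "val I t (B - {i}) = sum w (B - {i})" "val I t B = sum w B"
    using B(1) c by (intro val_eq_sum; blast)+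
  then show ?thesis
    using B(2)[of "B - {i}"] B(1) i finB by (auto simp: sum_diff1)
qed

text \<open>The strict bound \<open>w i < 1\<close> turns price 1 into a refusal to sell, however
  ties are broken.\<close>

lemma demand_price_less_1:
  assumes "\<And>i. i \<in> active I t \<Longrightarrow> 0 < p i" "i \<in> demand_set I t p"
  shows "p i < 1"
proof -
  note opt = demand_set_optimal[OF fin, of p]
  have "i \<in> active I t"
    using optimal_bundlesD(1)[OF opt] assms(2) by auto
  then show ?thesis
    using optimal_surplus_nonneg[OF opt assms] w(2)[of i] by simp
qed

lemma demand_set_ones: "demand_set I t (\<lambda>_. 1) = {}"
  using demand_price_less_1[of "\<lambda>_. 1"] by auto

text \<open>The empty bundle has utility 0, so the payment never exceeds the value of the bundle,
  which is below 1.\<close>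

lemma reward_bounds:
  assumes "\<And>i. i \<in> active I t \<Longrightarrow> 0 < p i"
  shows "0 \<le> reward I t p" "reward I t p \<le> 1"
proof -
  note D = optimal_bundlesD[OF demand_set_optimal[OF fin, of p]]
  show "0 \<le> reward I t p"
    unfolding reward_def using assms D(1) by (intro sum_nonneg) (auto intro: less_imp_le)
  have "val I t {} = 0"
    using val_eq_sum[of "{}"] by simp
  then show "reward I t p \<le> 1"
    unfolding reward_def using D(2)[of "{}"] val_lt_1[OF D(1)] by simp
qed

section \<open>Effect of raising prices to 1 on a set of resources\<close>

context
  fixes p p' :: price and M :: "nat set"
  assumes p_pos: "\<And>i. i \<in> active I t \<Longrightarrow> 0 < p i"
    and p_le_1: "\<And>i. i \<in> active I t \<Longrightarrow> p i \<le> 1"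
    and p'_def: "p' = (\<lambda>i. if i \<in> M then 1 else p i)"
begin

lemma p'_pos: "i \<in> active I t \<Longrightarrow> 0 < p' i"
  using p_pos by (simp add: p'_def)

lemma demand_raised_disjoint: "demand_set I t p' \<inter> M = {}"
proof -
  have "i \<notin> M" if "i \<in> demand_set I t p'" for i
    using demand_price_less_1[OF p'_pos that] by (auto simp: p'_def)
  then show ?thesis
    by auto
qed

text \<open>Both demand sets avoid \<open>M\<close>, so each costs the same under \<open>p\<close>
  and \<open>p'\<close>, while no bundle gets cheaper under \<open>p'\<close>. Hence each is optimal
  for both price vectors, and the common tie break picks the same one.\<close>

lemma demand_raised_eq:
  assumes "demand_set I t p \<inter> M = {}"
  shows "demand_set I t p' = demand_set I t p"
proof -
  let ?D = "demand_set I t p" and ?D' = "demand_set I t p'"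
  note D = optimal_bundlesD[OF demand_set_optimal[OF fin, of p]]
  note D' = optimal_bundlesD[OF demand_set_optimal[OF fin, of p']]
  have le: "sum p B \<le> sum p' B" if "B \<subseteq> active I t" for B
    using that p_le_1 by (intro sum_mono) (auto simp: p'_def)
  have D_eq: "sum p' ?D = sum p ?D"
    using assms by (intro sum.cong) (auto simp: p'_def)
  have D'_eq: "sum p' ?D' = sum p ?D'"
    using demand_raised_disjoint by (intro sum.cong) (auto simp: p'_def)
  have "?D \<in> optimal_bundles I t p'"
    unfolding optimal_bundles_def
  proof (intro CollectI conjI allI impI D(1))
    fix B assume B: "B \<subseteq> active I t"
    show "val I t B - sum p' B \<le> val I t ?D - sum p' ?D"
      using D(2)[OF B] le[OF B] D_eq by linarith
  qed
  moreover have "?D' \<in> optimal_bundles I t p"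
    unfolding optimal_bundles_def
  proof (intro CollectI conjI allI impI D'(1))
    fix B assume B: "B \<subseteq> active I t"
    show "val I t B - sum p B \<le> val I t ?D' - sum p ?D'"
      using D(2)[OF B] D'(2)[OF D(1)] D_eq D'_eq by linarith
  qed
  ultimately have "sorted_list_of_set ?D = sorted_list_of_set ?D'"
    by (intro antisym demand_set_least fin)
  then show ?thesis
    using D(1) D'(1) fin by (metis finite_subset sorted_list_of_set.set_sorted_key_list_of_set)
qed

text \<open>Exchange argument. If \<open>card D < k\<close>, adding an item \<open>j\<close> of \<open>D' - D\<close> to \<open>D\<close> or deleting it from \<open>D'\<close>
  shows that \<open>j\<close> has zero surplus; otherwise some \<open>y \<in> D - M - D'\<close> can be swapped with \<open>j\<close> in both sets,
  so \<open>y\<close> and \<open>j\<close> have equal surplus. In both cases the two lexicographic tie breaks contradict each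
  other. Full inclusion \<open>D - M \<subseteq> D'\<close> may fail, because zero-surplus items are bought only to
  improve a tie break.\<close>

lemma demand_raised_new_items:
  "card (demand_set I t p' - demand_set I t p) \<le> card (demand_set I t p \<inter> M)"
proof (rule ccontr)
  let ?D = "demand_set I t p" and ?D' = "demand_set I t p'"
  let ?u = "\<lambda>i. w i - p i" and ?L = "sorted_list_of_set :: nat set \<Rightarrow> nat list"
  assume "\<not> card (?D' - ?D) \<le> card (?D \<inter> M)"
  then have many: "card (?D \<inter> M) < card (?D' - ?D)"
    by simp
  note oD = demand_set_optimal[OF fin, of p] and oD' = demand_set_optimal[OF fin, of p']
  note D = optimal_bundlesD[OF oD] and D' = optimal_bundlesD[OF oD']
  note disj = demand_raised_disjoint
  have fD: "finite ?D" "finite ?D'"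
    using D(1) D'(1) fin finite_subset by blast+
  have cD: "card ?D \<le> k" "card ?D' \<le> k"
    using optimal_card_le[OF oD p_pos] optimal_card_le[OF oD' p'_pos] by auto
  \<comment> \<open>On bundles of at most \<open>k\<close> items utility is the additive surplus
    \<open>?u\<close>. For bundles avoiding \<open>M\<close> this remains true under
    \<open>p'\<close>, so both demand sets are compared through one function.\<close>
  have val: "val I t B - sum p B = sum ?u B" if "B \<subseteq> active I t" "card B \<le> k" for B
    using val_eq_sum[OF that] by (simp add: sum_subtractf)
  have val': "val I t B - sum p' B = sum ?u B"
    if "B \<subseteq> active I t" "card B \<le> k" "B \<inter> M = {}" for B
  proof -
    have "sum p' B = sum p B"
      using that by (intro sum.cong) (auto simp: p'_def)
    then show ?thesis
      using val[OF that(1,2)] by simp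
  qed
  have optD: "sum ?u B \<le> sum ?u ?D" if "B \<subseteq> active I t" "card B \<le> k" for B
    using D(2)[OF that(1)] val[OF that] val[OF D(1) cD(1)] by linarith
  have optD': "sum ?u B \<le> sum ?u ?D'" if "B \<subseteq> active I t" "card B \<le> k" "B \<inter> M = {}" for B
    using D'(2)[OF that(1)] val'[OF that] val'[OF D'(1) cD(2) disj] by linarith
  have leastD: "?L ?D \<le> ?L B"
    if "B \<subseteq> active I t" "card B \<le> k" "sum ?u B = sum ?u ?D" for B
  proof (rule demand_set_least[OF fin])
    show "B \<in> optimal_bundles I t p"
      unfolding optimal_bundles_def
      using that D val[OF that(1,2)] val[OF D(1) cD(1)] by auto
  qed
  have leastD': "?L ?D' \<le> ?L B"
    if "B \<subseteq> active I t" "card B \<le> k" "B \<inter> M = {}" "sum ?u B = sum ?u ?D'" for B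
  proof (rule demand_set_least[OF fin])
    show "B \<in> optimal_bundles I t p'"
      unfolding optimal_bundles_def
      using that D' val'[OF that(1-3)] val'[OF D'(1) cD(2) disj] by auto
  qed
  have X: "?D' - ?D \<noteq> {}"
    using many by (metis card.empty not_less_zero)
  show False
  proof (cases "card ?D < k")
    case True
    \<comment> \<open>The largest new item is chosen so that, once all of \<open>?D\<close> is known
      to lie below \<open>j\<close>, the rest of \<open>?D'\<close> lies below \<open>j\<close>
      too.\<close>
    define j where "j = Max (?D' - ?D)"
    have j: "j \<in> ?D'" "j \<notin> ?D" and j_max: "\<And>i. i \<in> ?D' - ?D \<Longrightarrow> i \<le> j"
      using Max_in[OF _ X] fD Max_ge[of "?D' - ?D"] unfolding j_def by auto
    have ins: "insert j ?D \<subseteq> active I t" "card (insert j ?D) \<le> k"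
      using j D(1) D'(1) True fD by auto
    have del: "?D' - {j} \<subseteq> active I t" "card (?D' - {j}) \<le> k" "(?D' - {j}) \<inter> M = {}"
      using D'(1) disj cD(2) card_Diff1_le[of ?D' j] by auto
    have s1: "sum ?u (insert j ?D) = ?u j + sum ?u ?D"
      using j fD by simp
    have s2: "sum ?u (?D' - {j}) = sum ?u ?D' - ?u j"
      using j fD by (simp add: sum_diff1)
    have u0: "?u j = 0"
      using optD[OF ins] optD'[OF del] s1 s2 by linarith
    have above: "e < j" if "e \<in> ?D" for e
    proof (rule ccontr)
      assume "\<not> e < j"
      then have "j < e"
        using that j by (cases "e = j") auto
      then have "?L (insert j ?D) < ?L ?D"
        using that j fD by (intro sorted_list_of_set_less[of _ _ j e]) auto
      then show False
        using leastD[OF ins] s1 u0 by auto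
    qed
    have "?L (?D' - {j}) < ?L (insert j (?D' - {j}))"
    proof (rule sorted_list_of_set_less_insert)
      show "e < j" if "e \<in> ?D' - {j}" for e
        using that above[of e] j_max[of e] by (cases "e \<in> ?D") auto
    qed (use fD in auto)
    then show False
      using leastD'[OF del] s2 u0 j by (auto simp: insert_absorb)
  next
    case False
    \<comment> \<open>Counting: \<open>?D'\<close> is no larger than \<open>?D\<close> but has more
      new items than \<open>?D\<close> has items in \<open>M\<close>, so it shares fewer than
      \<open>card (?D - M)\<close> items with \<open>?D\<close> and some item of
      \<open>?D - M\<close> is dropped.\<close>
    then have "card ?D' \<le> card ?D"
      using cD by simp
    moreover have "card ?D' = card (?D' - ?D) + card (?D' \<inter> ?D)"
      using fD by (metis card_Diff_subset_Int card_mono finite_Int inf_le1 le_add_diff_inverse2)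
    moreover have "?D = (?D \<inter> M) \<union> (?D - M)" "(?D \<inter> M) \<inter> (?D - M) = {}"
      by auto
    then have "card ?D = card (?D \<inter> M) + card (?D - M)"
      using fD by (metis card_Un_disjoint finite_Diff finite_Int)
    ultimately have "card (?D' \<inter> ?D) < card (?D - M)"
      using many by linarith
    then have "\<not> ?D - M \<subseteq> ?D' \<inter> ?D"
      using card_mono[of "?D' \<inter> ?D" "?D - M"] fD by auto
    then obtain y where y: "y \<in> ?D" "y \<notin> M" "y \<notin> ?D'"
      by auto
    obtain j where j: "j \<in> ?D'" "j \<notin> ?D"
      using X by auto
    let ?B = "insert j (?D - {y})" and ?B' = "insert y (?D' - {j})"
    have B: "?B \<subseteq> active I t" "card ?B \<le> k"
      using j(1) D(1) D'(1) cD(1) card_exchange[OF fD(1) y(1) j(2)] by auto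
    have B': "?B' \<subseteq> active I t" "card ?B' \<le> k" "?B' \<inter> M = {}"
      using y(1,2) D(1) D'(1) cD(2) card_exchange[OF fD(2) j(1) y(3)] disj by auto
    have s: "sum ?u ?B = ?u j + (sum ?u ?D - ?u y)" "sum ?u ?B' = ?u y + (sum ?u ?D' - ?u j)"
      using j y fD by (simp_all add: sum_diff1)
    have u: "?u j = ?u y"
      using optD[OF B] optD'[OF B'] s by linarith
    have "\<not> j < y"
    proof
      assume "j < y"
      then have "?L ?B < ?L ?D"
        using j y fD by (intro sorted_list_of_set_less[of _ _ j y]) auto
      then show False
        using leastD[OF B] s u by auto
    qed
    moreover have "\<not> y < j"
    proof
      assume "y < j"
      then have "?L ?B' < ?L ?D'"
        using j y fD by (intro sorted_list_of_set_less[of _ _ y j]) auto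
      then show False
        using leastD'[OF B'] s u by auto
    qed
    ultimately show False
      using j y by (metis nat_neq_iff)
  qed
qed

text \<open>The rewards need not be compared item by item: they coincide if \<open>D \<inter> M\<close> is empty, and otherwise the
  bound is at least 1.\<close>

lemma demand_raised_loss:
  "reward I t p - reward I t p' \<le> card (demand_set I t p \<inter> M)"
proof (cases "demand_set I t p \<inter> M = {}")
  case True
  then have "reward I t p' = reward I t p"
    unfolding reward_def demand_raised_eq[OF True] by (intro sum.cong) (auto simp: p'_def)
  then show ?thesis
    by simp
next
  case False
  have "finite (demand_set I t p)"
    using optimal_bundlesD(1)[OF demand_set_optimal[OF fin]] fin finite_subset by blast
  then have "1 \<le> card (demand_set I t p \<inter> M)"
    using False by (simp add: Suc_le_eq card_gt_0_iff)
  then show ?thesis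
    using reward_bounds(2)[OF p_pos] reward_bounds(1)[of p'] p'_pos by fastforce
qed

end

end

section \<open>The chasing oracle\<close>

text \<open>Truncated subtraction is intended: a surplus of the oracle on one resource does not
  offset a shortage on another.\<close>

definition deficit :: "inst \<Rightarrow> nat \<Rightarrow> state \<Rightarrow> state \<Rightarrow> nat" where
  "deficit I t s r = (\<Sum>i\<in>active I t. the (s i) - the (r i))"

definition scarce :: "state \<Rightarrow> state \<Rightarrow> nat set" where
  "scarce s r = {i \<in> dom s. the (r i) < the (s i)}"

definition chase_price :: "(state \<Rightarrow> price) \<Rightarrow> bool \<Rightarrow> state \<Rightarrow> state \<Rightarrow> price" where
  "chase_price \<gamma> b s r = (if b then dflt else (\<lambda>i. if i \<in> scarce s r then 1 else \<gamma> s i))"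

lemma card_eq_sum_if:
  assumes "finite A" "X \<subseteq> A"
  shows "card X = (\<Sum>i\<in>A. if i \<in> X then 1 else 0)"
  using assms by (simp add: sum.If_cases Int_absorb1)

text \<open>Balance per resource: a sale by the oracle alone raises the truncated difference by at
  most 1, and a sale of a scarce unit by the target lowers it by exactly 1, since by
  \<open>disj\<close> the oracle sells no scarce unit.\<close>

lemma deficit_trans:
  assumes fin: "finite (active I t)" "finite (active I (Suc t))"
    and dom: "dom s = active I t" "dom r = active I t"
    and D: "demand_set I t p \<subseteq> active I t" "demand_set I t p' \<subseteq> active I t"
    and disj: "demand_set I t p' \<inter> scarce s r = {}"
  shows "deficit I (Suc t) (trans I t s p) (trans I t r p') + card (demand_set I t p \<inter> scarce s r)
    \<le> deficit I t s r + card (demand_set I t p' - demand_set I t p)"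
proof -
  let ?A = "active I t" and ?A' = "active I (Suc t)"
  let ?D = "demand_set I t p" and ?D' = "demand_set I t p'" and ?M = "scarce s r"
  define g where "g i = (the (s i) - (if i \<in> ?D then 1 else 0)) - (the (r i) - (if i \<in> ?D' then 1 else 0))" for i
  \<comment> \<open>Arriving resources have full capacity in both inventories and contribute 0;
    departing ones drop out of the sum.\<close>
  have "deficit I (Suc t) (trans I t s p) (trans I t r p') = (\<Sum>i\<in>?A' \<inter> ?A. g i)"
    unfolding deficit_def
  proof (rule sum.mono_neutral_cong_right)
    show "the (trans I t s p i) - the (trans I t r p' i) = g i" if "i \<in> ?A' \<inter> ?A" for i
    proof -
      have "i \<in> dom s" "i \<in> dom r"
        using that dom by auto
      then show ?thesis
        using that by (auto simp: trans_def g_def)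
    qed
  qed (use fin in \<open>auto simp: trans_def\<close>)
  also have "\<dots> \<le> (\<Sum>i\<in>?A. g i)"
    by (rule sum_mono2) (use fin in auto)
  finally have "deficit I (Suc t) (trans I t s p) (trans I t r p') \<le> (\<Sum>i\<in>?A. g i)" .
  moreover have "card (?D \<inter> ?M) = (\<Sum>i\<in>?A. if i \<in> ?D \<inter> ?M then 1 else 0)"
    by (rule card_eq_sum_if) (use fin D in auto)
  ultimately have "deficit I (Suc t) (trans I t s p) (trans I t r p') + card (?D \<inter> ?M)
      \<le> (\<Sum>i\<in>?A. g i + (if i \<in> ?D \<inter> ?M then 1 else 0))"
    unfolding sum.distrib by linarith
  also have "\<dots> \<le> (\<Sum>i\<in>?A. (the (s i) - the (r i)) + (if i \<in> ?D' - ?D then 1 else 0))"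
  proof (rule sum_mono)
    fix i assume "i \<in> ?A"
    then have "i \<in> ?M \<longleftrightarrow> the (r i) < the (s i)"
      using dom by (simp add: scarce_def)
    moreover have "\<not> (i \<in> ?D' \<and> i \<in> ?M)"
      using disj by auto
    ultimately show "g i + (if i \<in> ?D \<inter> ?M then 1 else 0)
        \<le> (the (s i) - the (r i)) + (if i \<in> ?D' - ?D then 1 else 0)"
      unfolding g_def by auto
  qed
  also have "\<dots> = deficit I t s r + (\<Sum>i\<in>?A. if i \<in> ?D' - ?D then 1 else 0)"
    by (simp add: sum.distrib deficit_def)
  also have "(\<Sum>i\<in>?A. if i \<in> ?D' - ?D then 1 else 0) = card (?D' - ?D)"
    by (rule card_eq_sum_if[symmetric]) (use fin D in auto)
  finally show ?thesis .
qed

context k_demand_user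
begin

context
  fixes s r :: state and \<gamma> :: "state \<Rightarrow> price"
  assumes fin_next: "finite (active I (Suc t))"
    and dom: "dom s = active I t" "dom r = active I t"
    and feas: "feasible s (\<gamma> s)"
begin

text \<open>If the oracle has run out of \<open>i\<close>, then either so has the target, whose own
  price is 1, or \<open>i\<close> is scarce and its price is raised to 1.\<close>

lemma feasible_chase_price: "feasible r (chase_price \<gamma> b s r)"
proof -
  have "0 < chase_price \<gamma> b s r i \<and> chase_price \<gamma> b s r i \<le> 1 \<and>
      (r i = Some 0 \<longrightarrow> chase_price \<gamma> b s r i = 1)" if "i \<in> dom r" for i
  proof -
    have "i \<in> dom s"
      using that unfolding dom by simp
    then obtain n where n: "s i = Some n"
      by blast
    have "0 < \<gamma> s i \<and> \<gamma> s i \<le> 1 \<and> (s i = Some 0 \<longrightarrow> \<gamma> s i = 1)"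
      using feas \<open>i \<in> dom s\<close> unfolding feasible_def by (rule bspec)
    then show ?thesis
      using n by (auto simp: chase_price_def dflt_def scarce_def)
  qed
  then show ?thesis
    by (simp add: feasible_def)
qed

lemma policy_price_bounds:
  assumes "i \<in> active I t"
  shows "0 < \<gamma> s i" "\<gamma> s i \<le> 1"
  using feas assms dom by (auto simp: feasible_def)

lemma chase_price_pos: "i \<in> active I t \<Longrightarrow> 0 < chase_price \<gamma> b s r i"
  using feasible_chase_price dom by (simp add: feasible_def)

lemma chase_loss_le_1: "reward I t (\<gamma> s) - reward I t (chase_price \<gamma> b s r) \<le> 1"
proof -
  have "reward I t (\<gamma> s) \<le> 1"
    by (rule reward_bounds(2)) (rule policy_price_bounds(1))
  moreover have "0 \<le> reward I t (chase_price \<gamma> b s r)"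
    by (rule reward_bounds(1)) (rule chase_price_pos)
  ultimately show ?thesis
    by simp
qed

lemma chase_deficit_explore:
  "deficit I (Suc t) (trans I t s (\<gamma> s)) (trans I t r (chase_price \<gamma> True s r)) +
     card (demand_set I t (\<gamma> s) \<inter> scarce s r) \<le> deficit I t s r"
proof -
  have "demand_set I t (chase_price \<gamma> True s r) = {}"
    using demand_set_ones by (simp add: chase_price_def dflt_def)
  then show ?thesis
    using deficit_trans[OF fin fin_next dom, of "\<gamma> s" "chase_price \<gamma> True s r"]
      optimal_bundlesD(1)[OF demand_set_optimal[OF fin]] by simp
qed

text \<open>\<open>demand_raised_new_items\<close> makes the two cardinalities in
  \<open>deficit_trans\<close> cancel: scarce units sold by the target alone pay for the oracle's
  additional sales.\<close>

lemma chase_exploit: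
  shows "deficit I (Suc t) (trans I t s (\<gamma> s)) (trans I t r (chase_price \<gamma> False s r)) \<le> deficit I t s r"
    and "reward I t (\<gamma> s) - reward I t (chase_price \<gamma> False s r) \<le>
      card (demand_set I t (\<gamma> s) \<inter> scarce s r)"
proof -
  have p': "chase_price \<gamma> False s r = (\<lambda>i. if i \<in> scarce s r then 1 else \<gamma> s i)"
    by (simp add: chase_price_def)
  have disj: "demand_set I t (chase_price \<gamma> False s r) \<inter> scarce s r = {}"
    by (rule demand_raised_disjoint[OF _ _ p']) (simp_all add: policy_price_bounds)
  have new: "card (demand_set I t (chase_price \<gamma> False s r) - demand_set I t (\<gamma> s)) \<le>
      card (demand_set I t (\<gamma> s) \<inter> scarce s r)"
    by (rule demand_raised_new_items[OF _ _ p']) (simp_all add: policy_price_bounds)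
  show "deficit I (Suc t) (trans I t s (\<gamma> s)) (trans I t r (chase_price \<gamma> False s r)) \<le> deficit I t s r"
    using deficit_trans[OF fin fin_next dom
        optimal_bundlesD(1)[OF demand_set_optimal[OF fin]]
        optimal_bundlesD(1)[OF demand_set_optimal[OF fin]] disj, of "\<gamma> s"] new by linarith
  show "reward I t (\<gamma> s) - reward I t (chase_price \<gamma> False s r) \<le>
      card (demand_set I t (\<gamma> s) \<inter> scarce s r)"
    by (rule demand_raised_loss[OF _ _ p']) (simp_all add: policy_price_bounds)
qed

end

end

section \<open>Causality: what the observed data determine\<close>

lemma view_eqD:
  assumes "view I t = view J t" "s \<le> t"
  shows "active I s = active J s"
    and "i \<in> active I s \<Longrightarrow> cap I i = cap J i"
    and "B \<subseteq> active I s \<Longrightarrow> val I s B = val J s B"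
proof -
  have eq: "rinfo I s = rinfo J s"
    using fun_cong[OF assms(1), of s] assms(2) by (simp add: view_def)
  then show act: "active I s = active J s"
    by (simp add: rinfo_def)
  have c: "(\<lambda>i. if i \<in> active I s then cap I i else 0) = (\<lambda>i. if i \<in> active I s then cap J i else 0)"
    and v: "(\<lambda>B. if B \<subseteq> active I s then val I s B else 0) =
      (\<lambda>B. if B \<subseteq> active I s then val J s B else 0)"
    using eq act by (simp_all add: rinfo_def)
  show "i \<in> active I s \<Longrightarrow> cap I i = cap J i"
    using fun_cong[OF c, of i] by simp
  show "B \<subseteq> active I s \<Longrightarrow> val I s B = val J s B"
    using fun_cong[OF v, of B] by simp
qed

lemma obs_eqD:
  assumes "obs I t = obs J t"
  shows "active I t = active J t"
    and "i \<in> active I t \<Longrightarrow> cap I i = cap J i"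
    and "s < t \<Longrightarrow> view I s = view J s"
proof -
  show act: "active I t = active J t"
    using assms by (simp add: obs_def)
  have c: "(\<lambda>i. if i \<in> active I t then cap I i else 0) = (\<lambda>i. if i \<in> active I t then cap J i else 0)"
    and h: "(\<lambda>s. if s < t then Some (rinfo I s) else None) = (\<lambda>s. if s < t then Some (rinfo J s) else None)"
    using assms act by (simp_all add: obs_def)
  show "i \<in> active I t \<Longrightarrow> cap I i = cap J i"
    using fun_cong[OF c, of i] by simp
  show "view I s = view J s" if "s < t"
  proof
    fix u
    show "view I s u = view J s u"
      using fun_cong[OF h, of u] that by (auto simp: view_def)
  qed
qed

text \<open>\<open>view\<close> at round \<open>t\<close> includes the valuation of that round,
  which \<open>obs\<close> withholds.\<close>

lemma view_eq_imp_obs_eq: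
  assumes "view I t = view J t"
  shows "obs I t = obs J t"
proof -
  have "rinfo I s = rinfo J s" if "s < t" for s
    using fun_cong[OF assms, of s] that by (simp add: view_def)
  then show ?thesis
    using view_eqD[OF assms order.refl] by (auto simp: obs_def)
qed

lemma obs_eq_mono: "obs I t = obs J t \<Longrightarrow> s \<le> t \<Longrightarrow> obs I s = obs J s"
  using obs_eqD(3)[of I t J s] view_eq_imp_obs_eq[of I s J] by (cases "s = t") auto

lemma demand_set_cong:
  assumes "view I t = view J t"
  shows "demand_set I t p = demand_set J t p"
proof -
  have "optimal_bundles I t p = optimal_bundles J t p"
    unfolding optimal_bundles_def view_eqD(1)[OF assms order.refl, symmetric]
    using view_eqD(3)[OF assms order.refl] by (intro Collect_cong conj_cong) auto
  then show ?thesis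
    unfolding demand_set_def Let_def optimal_bundles_def by simp
qed

lemma reward_cong: "view I t = view J t \<Longrightarrow> reward I t p = reward J t p"
  using demand_set_cong[of I t J p] by (simp add: reward_def)

text \<open>The observation at \<open>Suc t\<close> is just enough: it contains the valuation of
  round \<open>t\<close> and the capacities of the resources arriving next.\<close>

lemma trans_cong:
  assumes "obs I (Suc t) = obs J (Suc t)"
  shows "trans I t s p = trans J t s p"
proof -
  have v: "view I t = view J t"
    using obs_eqD(3)[OF assms] by simp
  show ?thesis
    unfolding trans_def
    using obs_eqD(1,2)[OF assms] view_eqD(1)[OF v order.refl] demand_set_cong[OF v]
    by (intro ext) simp
qed

lemma pol_st_cong: "obs I (Suc n) = obs J (Suc n) \<Longrightarrow> pol_st I \<gamma> n = pol_st J \<gamma> n"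
proof (induction n)
  case 0
  then show ?case
    using obs_eqD(1,2)[OF 0] by (auto simp: init_state_def)
next
  case (Suc n)
  then have "pol_st I \<gamma> n = pol_st J \<gamma> n"
    using obs_eq_mono[of I "Suc (Suc n)" J "Suc n"] by auto
  then show ?case
    using trans_cong[OF Suc.prems] by simp
qed

lemma policy_state_cong:
  "obs I t = obs J t \<Longrightarrow> 1 \<le> t \<Longrightarrow> policy_state I \<gamma> t = policy_state J \<gamma> t"
  using pol_st_cong[of I "t - 1" J \<gamma>] by (simp add: policy_state_def)

lemma policy_state_Suc:
  "1 \<le> t \<Longrightarrow> policy_state I \<gamma> (Suc t) =
     trans I t (policy_state I \<gamma> t) (\<gamma> (policy_state I \<gamma> t))"
  by (cases t) (auto simp: policy_state_def)

lemma dom_trans: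
  assumes "dom s = active I t"
  shows "dom (trans I t s p) = active I (Suc t)"
proof -
  have "s i \<noteq> None" if "i \<in> active I t" for i
    using that assms by (simp add: dom_def set_eq_iff)
  then show ?thesis
    by (auto simp: trans_def dom_def)
qed

lemma dom_policy_state:
  assumes "1 \<le> t"
  shows "dom (policy_state I \<gamma> t) = active I t"
  using assms
proof (induction t rule: dec_induct)
  case base
  then show ?case
    by (auto simp: policy_state_def init_state_def dom_def)
next
  case (step t)
  then show ?case
    using policy_state_Suc[of t I \<gamma>] dom_trans by simp
qed

text \<open>A pricing policy is feasible only at inventory vectors, so the simulated states must
  respect the bound \<open>C\<close>. The bound also limits the initial deficit.\<close>

lemma policy_state_le:
  assumes cap: "\<And>i. i \<in> res I \<Longrightarrow> cap I i \<le> C" and t: "1 \<le> t"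
    and some: "policy_state I \<gamma> t i = Some n"
  shows "n \<le> C"
  using t some
proof (induction t arbitrary: n rule: dec_induct)
  case base
  then show ?case
    using cap by (auto simp: policy_state_def init_state_def active_def split: if_splits)
next
  case (step t)
  have "trans I t (policy_state I \<gamma> t) (\<gamma> (policy_state I \<gamma> t)) i = Some n"
    using step policy_state_Suc[of t I \<gamma>] by simp
  then consider "i \<in> active I (Suc t)" "n = cap I i"
    | m where "policy_state I \<gamma> t i = Some m" "n \<le> m"
    by (auto simp: trans_def split: if_splits)
  then show ?case
  proof cases
    case 1
    then show ?thesis
      using cap by (simp add: active_def)
  next
    case 2
    then show ?thesis
      using step.IH by fastforce
  qed
qed

section \<open>The oracle's strategy for given coin flips\<close>

primrec chase_st ::
  "(state \<Rightarrow> price) \<Rightarrow> nat \<Rightarrow> state \<Rightarrow> (nat \<Rightarrow> bool) \<Rightarrow> inst \<Rightarrow> nat \<Rightarrow> state" where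
  "chase_st \<gamma> t0 s0 b I 0 = s0"
| "chase_st \<gamma> t0 s0 b I (Suc n) = trans I (t0 + n) (chase_st \<gamma> t0 s0 b I n)
     (chase_price \<gamma> (b (t0 + n)) (policy_state I \<gamma> (t0 + n)) (chase_st \<gamma> t0 s0 b I n))"

definition chase_action ::
  "(state \<Rightarrow> price) \<Rightarrow> nat \<Rightarrow> state \<Rightarrow> (nat \<Rightarrow> bool) \<Rightarrow> inst \<Rightarrow> nat \<Rightarrow> price" where
  "chase_action \<gamma> t0 s0 b I t =
     chase_price \<gamma> (b t) (policy_state I \<gamma> t) (chase_st \<gamma> t0 s0 b I (t - t0))"

text \<open>Any instance compatible with the observation may be used to simulate both inventories, since
  neither of them depends on unobserved data.\<close>

definition chase_oracle ::
  "(state \<Rightarrow> price) \<Rightarrow> nat \<Rightarrow> state \<Rightarrow> (nat \<Rightarrow> bool) \<Rightarrow> nat \<Rightarrow> observation \<Rightarrow> price" where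
  "chase_oracle \<gamma> t0 s0 b t ob = chase_action \<gamma> t0 s0 b (SOME I. obs I t = ob) t"

lemma chase_st_cong:
  assumes "obs I (t0 + n) = obs J (t0 + n)" "1 \<le> t0" "\<And>s. s < t0 + n \<Longrightarrow> b s = b' s"
  shows "chase_st \<gamma> t0 s0 b I n = chase_st \<gamma> t0 s0 b' J n"
  using assms
proof (induction n)
  case 0
  then show ?case
    by simp
next
  case (Suc n)
  have o: "obs I (t0 + n) = obs J (t0 + n)"
    using obs_eq_mono[OF Suc.prems(1), of "t0 + n"] by simp
  have IH: "chase_st \<gamma> t0 s0 b I n = chase_st \<gamma> t0 s0 b' J n"
    by (rule Suc.IH[OF o Suc.prems(2)]) (simp add: Suc.prems(3))
  have p: "policy_state I \<gamma> (t0 + n) = policy_state J \<gamma> (t0 + n)"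
    using policy_state_cong[OF o] Suc.prems(2) by simp
  have "trans I (t0 + n) s x = trans J (t0 + n) s x" for s x
    using Suc.prems(1) by (intro trans_cong) simp
  then show ?case
    using IH p Suc.prems(3)[of "t0 + n"] by simp
qed

lemma chase_action_cong:
  assumes "obs I t = obs J t" "1 \<le> t0" "t0 \<le> t" "\<And>s. s \<le> t \<Longrightarrow> b s = b' s"
  shows "chase_action \<gamma> t0 s0 b I t = chase_action \<gamma> t0 s0 b' J t"
proof -
  have "chase_st \<gamma> t0 s0 b I (t - t0) = chase_st \<gamma> t0 s0 b' J (t - t0)"
    using assms by (intro chase_st_cong) auto
  moreover have "policy_state I \<gamma> t = policy_state J \<gamma> t"
    using assms by (intro policy_state_cong) auto
  ultimately show ?thesis
    using assms(4) by (simp add: chase_action_def)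
qed

lemma chase_oracle_obs:
  assumes "1 \<le> t0" "t0 \<le> t"
  shows "chase_oracle \<gamma> t0 s0 b t (obs I t) = chase_action \<gamma> t0 s0 b I t"
proof -
  have "obs (SOME J. obs J t = obs I t) t = obs I t"
    by (rule someI) simp
  then show ?thesis
    unfolding chase_oracle_def using assms by (intro chase_action_cong) auto
qed

lemma act_pre_stable:
  assumes "n \<le> m" "s < n"
  shows "act_pre orc adv t0 m s = act_pre orc adv t0 n s"
  using assms by (induction m rule: dec_induct) auto

text \<open>\<open>act_pre\<close> consults the adversary on a prefix of the actions only. By
  causality the finally realised instance yields the same observation, so a single instance can be
  used for all rounds.\<close>

lemma actions_eq:
  assumes causal: "causal_adversary adv" and t: "t \<le> T"
  shows "actions orc adv t0 T t =
    (if t < t0 then dflt else orc t (obs (adv (actions orc adv t0 T)) t))"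
proof -
  let ?xs = "actions orc adv t0 T" and ?ys = "act_pre orc adv t0 t"
  have "\<forall>s<t. ?ys s = ?xs s"
    using act_pre_stable[of t "Suc T" _ orc adv t0] t by (auto simp: actions_def)
  then have "view (adv ?ys) t = view (adv ?xs) t"
    using causal unfolding causal_adversary_def by blast
  then have "obs (adv ?ys) t = obs (adv ?xs) t"
    by (rule view_eq_imp_obs_eq)
  moreover have "?xs t = act_pre orc adv t0 (Suc t) t"
    using act_pre_stable[of "Suc t" "Suc T" t orc adv t0] t by (simp add: actions_def)
  ultimately show ?thesis
    by simp
qed

section \<open>Expected loss\<close>

text \<open>New flips are appended at the end, so that a list is a history and
  \<open>l @ [b]\<close> is its extension by one round.\<close>

primrec coin_flips :: "real \<Rightarrow> nat \<Rightarrow> bool list pmf" where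
  "coin_flips \<epsilon> 0 = return_pmf []"
| "coin_flips \<epsilon> (Suc n) =
     bind_pmf (coin_flips \<epsilon> n) (\<lambda>l. map_pmf (\<lambda>b. l @ [b]) (bernoulli_pmf \<epsilon>))"

lemma length_coin_flips: "l \<in> set_pmf (coin_flips \<epsilon> n) \<Longrightarrow> length l = n"
  by (induction n arbitrary: l) auto

lemma finite_coin_flips: "finite (set_pmf (coin_flips \<epsilon> n))"
  by (induction n) auto

text \<open>A supermartingale argument with drift: conditioning on the first \<open>n\<close> flips,
  one more flip raises the mean of \<Phi> by at most \<open>d\<close>.\<close>

lemma expectation_coin_flips_le:
  fixes \<Phi> :: "bool list \<Rightarrow> real"
  assumes \<epsilon>: "0 \<le> \<epsilon>" "\<epsilon> \<le> 1"
    and step: "\<And>l. \<epsilon> * \<Phi> (l @ [True]) + (1 - \<epsilon>) * \<Phi> (l @ [False]) \<le> \<Phi> l + d"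
  shows "measure_pmf.expectation (coin_flips \<epsilon> n) \<Phi> \<le> \<Phi> [] + real n * d"
proof (induction n)
  case 0
  then show ?case
    by simp
next
  case (Suc n)
  let ?p = "coin_flips \<epsilon> n"
  have "measure_pmf.expectation (coin_flips \<epsilon> (Suc n)) \<Phi> =
      (\<Sum>l\<in>set_pmf ?p. pmf ?p l *\<^sub>R
        measure_pmf.expectation (map_pmf (\<lambda>b. l @ [b]) (bernoulli_pmf \<epsilon>)) \<Phi>)"
    unfolding coin_flips.simps by (rule pmf_expectation_bind) (auto simp: finite_coin_flips)
  also have "\<dots> \<le> (\<Sum>l\<in>set_pmf ?p. pmf ?p l *\<^sub>R (\<Phi> l + d))"
  proof (intro sum_mono scaleR_left_mono)
    show "measure_pmf.expectation (map_pmf (\<lambda>b. l @ [b]) (bernoulli_pmf \<epsilon>)) \<Phi> \<le> \<Phi> l + d" for l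
      using \<epsilon> step[of l] by (simp add: mult.commute)
  qed simp
  also have "\<dots> = measure_pmf.expectation ?p (\<lambda>l. \<Phi> l + d)"
    by (rule integral_measure_pmf[symmetric]) (auto simp: finite_coin_flips)
  also have "\<dots> = measure_pmf.expectation ?p \<Phi> + d"
    by (simp add: integrable_measure_pmf_finite finite_coin_flips)
  finally show ?case
    using Suc by (simp add: algebra_simps)
qed

text \<open>The first flip belongs to round \<open>t0\<close>. Rounds not covered by the list
  default to exploiting, which makes \<open>flips t0 l\<close> total for every history
  \<open>l\<close>.\<close>

definition flips :: "nat \<Rightarrow> bool list \<Rightarrow> nat \<Rightarrow> bool" where
  "flips t0 l t \<longleftrightarrow> t0 \<le> t \<and> t - t0 < length l \<and> l ! (t - t0)"

lemma flips_append: "t < t0 + length l \<Longrightarrow> flips t0 (l @ l') t = flips t0 l t"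
  by (auto simp: flips_def nth_append)

lemma flips_snoc: "flips t0 (l @ [b]) (t0 + length l) = b"
  by (simp add: flips_def)

section \<open>The oracle against a fixed adaptive adversary\<close>

locale chase =
  fixes C W T t0 :: nat and \<gamma> :: "state \<Rightarrow> price" and s0 :: state
    and adv :: "(nat \<Rightarrow> price) \<Rightarrow> inst"
  assumes policy: "pricing_policy C \<gamma>"
    and t0: "1 \<le> t0" "t0 \<le> T"
    and adv: "admissible_adversary C W T t0 s0 adv"
begin

definition acts :: "(nat \<Rightarrow> bool) \<Rightarrow> nat \<Rightarrow> price" where
  "acts b = actions (chase_oracle \<gamma> t0 s0 b) adv t0 T"

text \<open>The realised instance depends on the flips, because the adversary reacts to the posted
  prices.\<close>

definition real_inst :: "(nat \<Rightarrow> bool) \<Rightarrow> inst" where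
  "real_inst b = adv (acts b)"

definition target :: "(nat \<Rightarrow> bool) \<Rightarrow> nat \<Rightarrow> state" where
  "target b t = policy_state (real_inst b) \<gamma> t"

definition chaser :: "(nat \<Rightarrow> bool) \<Rightarrow> nat \<Rightarrow> state" where
  "chaser b t = chase_st \<gamma> t0 s0 b (real_inst b) (t - t0)"

definition loss :: "(nat \<Rightarrow> bool) \<Rightarrow> nat \<Rightarrow> real" where
  "loss b t = reward (real_inst b) t (\<gamma> (target b t)) - reward (real_inst b) t (acts b t)"

text \<open>Round \<open>t\<close> is excluded, so that \<open>gap\<close> and \<open>lag\<close> at
  \<open>t\<close> both describe the start of round \<open>t\<close>.\<close>

definition gap :: "(nat \<Rightarrow> bool) \<Rightarrow> nat \<Rightarrow> real" where
  "gap b t = (\<Sum>u\<in>{t0..<t}. loss b u)"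

definition lag :: "(nat \<Rightarrow> bool) \<Rightarrow> nat \<Rightarrow> nat" where
  "lag b t = deficit (real_inst b) t (target b t) (chaser b t)"

definition missed :: "(nat \<Rightarrow> bool) \<Rightarrow> nat \<Rightarrow> nat" where
  "missed b t = card (demand_set (real_inst b) t (\<gamma> (target b t)) \<inter> scarce (target b t) (chaser b t))"

lemma causal: "causal_adversary adv"
  using adv by (simp add: admissible_adversary_def)

lemma view_adv_eq: "(\<And>s. s < t \<Longrightarrow> xs s = ys s) \<Longrightarrow> view (adv xs) t = view (adv ys) t"
  using causal unfolding causal_adversary_def by blast

lemma instance_adv: "dracc_instance C W T (adv xs)"
  using adv by (simp add: admissible_adversary_def)

lemma finite_active: "finite (active (adv xs) t)"
  using instance_adv[of xs] by (simp add: dracc_instance_def active_def)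

lemma card_active_le: "t \<in> {1..T} \<Longrightarrow> card (active (adv xs) t) \<le> W"
  using instance_adv[of xs] by (simp add: dracc_instance_def)

lemma k_demand_user:
  assumes "t \<in> {1..T}"
  obtains k w where "k_demand_user (adv xs) t k w" "1 \<le> k" "k \<le> card (active (adv xs) t)"
proof -
  have "k_demand (active (adv xs) t) (val (adv xs) t)"
    using adv assms by (simp add: admissible_adversary_def k_demand_instance_def)
  then obtain k w where kw: "1 \<le> k" "k \<le> card (active (adv xs) t)"
    "\<forall>i\<in>active (adv xs) t. 0 \<le> w i \<and> w i < 1"
    "\<forall>B. B \<subseteq> active (adv xs) t \<longrightarrow>
      val (adv xs) t B = Max {sum w B' | B'. B' \<subseteq> B \<and> card B' \<le> k}"
    unfolding k_demand_def by blast
  have "\<forall>B. B \<subseteq> active (adv xs) t \<longrightarrow> val (adv xs) t B < 1"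
    using instance_adv[of xs] assms by (simp add: dracc_instance_def valuation_on_def)
  then have "k_demand_user (adv xs) t k w"
    using kw finite_active[of xs t] by unfold_locales auto
  then show ?thesis
    using that kw by blast
qed

lemma capacity_width_pos: "0 < C * W"
proof -
  let ?A = "active (adv (\<lambda>_. dflt)) t0"
  obtain k w where "1 \<le> k" "k \<le> card ?A"
    using k_demand_user[of t0 "\<lambda>_. dflt"] t0 by auto
  then have card: "0 < card ?A"
    by simp
  then obtain i where "i \<in> ?A"
    by (metis card.empty equals0I less_irrefl)
  then have "0 < C"
    using instance_adv[of "\<lambda>_. dflt"] by (force simp: active_def dracc_instance_def)
  then show ?thesis
    using card card_active_le[of t0 "\<lambda>_. dflt"] t0 by simp
qed

lemma acts_eq:
  assumes "t \<le> T"
  shows "acts b t = (if t < t0 then dflt else chase_action \<gamma> t0 s0 b (real_inst b) t)"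
  using actions_eq[OF causal assms, of "chase_oracle \<gamma> t0 s0 b" t0] chase_oracle_obs[OF t0(1)]
  by (simp add: acts_def real_inst_def)

lemma acts_chase_price:
  assumes "t0 \<le> t" "t \<le> T"
  shows "acts b t = chase_price \<gamma> (b t) (target b t) (chaser b t)"
  using acts_eq[OF assms(2)] assms(1) by (simp add: chase_action_def target_def chaser_def)

text \<open>Nonanticipation, by induction over rounds: equal earlier actions give equal observations
  by causality, and with the same flip the same next action.\<close>

lemma acts_cong:
  assumes "t \<le> Suc T" "\<And>s. s < t \<Longrightarrow> b s = b' s"
  shows "s < t \<Longrightarrow> acts b s = acts b' s"
  using assms
proof (induction t arbitrary: s)
  case 0
  then show ?case
    by simp
next
  case (Suc t)
  have IH: "acts b s = acts b' s" if "s < t" for s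
    using Suc.IH[OF that] Suc.prems by simp
  show ?case
  proof (cases "s = t")
    case True
    have "obs (real_inst b) t = obs (real_inst b') t"
      unfolding real_inst_def by (intro view_eq_imp_obs_eq view_adv_eq IH)
    then have "t0 \<le> t \<Longrightarrow> chase_action \<gamma> t0 s0 b (real_inst b) t = chase_action \<gamma> t0 s0 b' (real_inst b') t"
      using t0 Suc.prems(3) by (intro chase_action_cong) auto
    then show ?thesis
      using True Suc.prems(2) acts_eq[of t] by simp
  qed (use IH Suc.prems in simp)
qed

context
  fixes b b' :: "nat \<Rightarrow> bool" and t :: nat
  assumes t: "t \<le> Suc T" and agree: "\<And>s. s < t \<Longrightarrow> b s = b' s"
begin

lemma view_real_inst_cong: "view (real_inst b) t = view (real_inst b') t"
  unfolding real_inst_def by (intro view_adv_eq acts_cong[of t] t agree)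

lemma target_cong: "1 \<le> t \<Longrightarrow> target b t = target b' t"
  unfolding target_def by (intro policy_state_cong view_eq_imp_obs_eq view_real_inst_cong)

lemma chaser_cong:
  assumes "t0 \<le> t"
  shows "chaser b t = chaser b' t"
  unfolding chaser_def
  using view_eq_imp_obs_eq[OF view_real_inst_cong] assms t0 agree by (intro chase_st_cong) auto

lemma lag_cong: "t0 \<le> t \<Longrightarrow> lag b t = lag b' t"
  using target_cong chaser_cong t0 view_eqD(1)[OF view_real_inst_cong order.refl]
  by (simp add: lag_def deficit_def)

lemma missed_cong: "t0 \<le> t \<Longrightarrow> missed b t = missed b' t"
  using target_cong chaser_cong t0 demand_set_cong[OF view_real_inst_cong]
  by (simp add: missed_def)

end

text \<open>Unlike quantities fixed at the start of round \<open>t\<close>, the loss depends on the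
  flip of round \<open>t\<close> too; hence the weak inequality.\<close>

lemma loss_cong:
  assumes "t0 \<le> t" "t \<le> T" "\<And>s. s \<le> t \<Longrightarrow> b s = b' s"
  shows "loss b t = loss b' t"
proof -
  have a: "\<And>s. s < t \<Longrightarrow> b s = b' s" "t \<le> Suc T"
    using assms by auto
  have "acts b t = acts b' t"
    using acts_cong[of "Suc t" b b' t] assms by simp
  then show ?thesis
    using target_cong[OF a(2,1)] reward_cong[OF view_real_inst_cong[OF a(2,1)]] assms t0
    by (simp add: loss_def)
qed

lemma gap_cong: "t \<le> Suc T \<Longrightarrow> (\<And>s. s < t \<Longrightarrow> b s = b' s) \<Longrightarrow> gap b t = gap b' t"
  unfolding gap_def by (intro sum.cong refl loss_cong) auto

lemma dom_chaser:
  assumes "t0 \<le> t"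
  shows "dom (chaser b t) = active (real_inst b) t"
proof -
  have "dom (chase_st \<gamma> t0 s0 b (real_inst b) n) = active (real_inst b) (t0 + n)" for n
  proof (induction n)
    case 0
    \<comment> \<open>Before \<open>t0\<close> only default prices are posted, so the active set at
      \<open>t0\<close> is the one that \<open>admissible_adversary\<close> ties to
      \<open>dom s0\<close>.\<close>
    have "acts b s = dflt" if "s < t0" for s
      using acts_eq[of s b] that t0 by simp
    then have "view (real_inst b) t0 = view (adv (\<lambda>_. dflt)) t0"
      unfolding real_inst_def by (intro view_adv_eq)
    then show ?case
      using view_eqD(1) adv by (simp add: admissible_adversary_def)
  next
    case (Suc n)
    then show ?case
      using dom_trans by simp
  qed
  from this[of "t - t0"] show ?thesis
    using assms by (simp add: chaser_def)
qed

lemma target_le: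
  assumes "1 \<le> t" "target b t i = Some n"
  shows "n \<le> C"
  using policy_state_le[of "real_inst b" C t \<gamma> i n] instance_adv[of "acts b"] assms
  by (simp add: target_def real_inst_def dracc_instance_def)

lemma dom_target: "1 \<le> t \<Longrightarrow> dom (target b t) = active (real_inst b) t"
  by (simp add: target_def dom_policy_state)

lemma feasible_target:
  assumes "1 \<le> t"
  shows "feasible (target b t) (\<gamma> (target b t))"
proof -
  have "inventory_vector C (target b t)"
    using target_le[OF assms] dom_target[OF assms] finite_active
    by (auto simp: inventory_vector_def real_inst_def)
  then show ?thesis
    using policy by (simp add: pricing_policy_def)
qed

lemma chaser_Suc:
  assumes "t0 \<le> t" "t \<le> T"
  shows "chaser b (Suc t) = trans (real_inst b) t (chaser b t) (acts b t)"
  using acts_chase_price[OF assms, of b] assms(1) Suc_diff_le[of t0 t]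
  by (simp add: chaser_def target_def)

lemma target_Suc:
  "t0 \<le> t \<Longrightarrow> target b (Suc t) = trans (real_inst b) t (target b t) (\<gamma> (target b t))"
  using policy_state_Suc t0 by (simp add: target_def)

lemma round_bounds:
  assumes t: "t0 \<le> t" "t \<le> T"
  shows "feasible (chaser b t) (acts b t)"
    and "loss b t \<le> 1"
    and "b t \<Longrightarrow> lag b (Suc t) + missed b t \<le> lag b t"
    and "\<not> b t \<Longrightarrow> lag b (Suc t) \<le> lag b t"
    and "\<not> b t \<Longrightarrow> loss b t \<le> real (missed b t)"
proof -
  have t1: "1 \<le> t" "t \<in> {1..T}"
    using t t0 by auto
  obtain k w where "k_demand_user (real_inst b) t k w"
    using k_demand_user[OF t1(2)] unfolding real_inst_def by blast
  then interpret k_demand_user "real_inst b" t k w .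
  have finS: "finite (active (real_inst b) (Suc t))"
    by (simp add: real_inst_def finite_active)
  note chase_facts = finS dom_target[OF t1(1), of b] dom_chaser[OF t(1), of b] feasible_target[OF t1(1), of b]
  note unf = acts_chase_price[OF t, of b] target_Suc[OF t(1), of b] chaser_Suc[OF t, of b]
  show "feasible (chaser b t) (acts b t)"
    using feasible_chase_price[where \<gamma> = \<gamma>, OF chase_facts] by (simp add: unf)
  show "loss b t \<le> 1"
    using chase_loss_le_1[where \<gamma> = \<gamma>, OF chase_facts] by (simp add: loss_def unf)
  show "b t \<Longrightarrow> lag b (Suc t) + missed b t \<le> lag b t"
    using chase_deficit_explore[where \<gamma> = \<gamma>, OF chase_facts] by (simp add: lag_def missed_def unf)
  show "\<not> b t \<Longrightarrow> lag b (Suc t) \<le> lag b t" "\<not> b t \<Longrightarrow> loss b t \<le> real (missed b t)"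
    using chase_exploit[where \<gamma> = \<gamma>, OF chase_facts] by (simp_all add: lag_def missed_def loss_def unf)
qed

text \<open>Whatever \<open>s0\<close> is, the deficit is at most the target's stock: at most
  \<open>W\<close> resources with at most \<open>C\<close> units each.\<close>

lemma lag_init: "lag b t0 \<le> C * W"
proof -
  have "the (target b t0 i) - the (chaser b t0 i) \<le> C" if "i \<in> active (real_inst b) t0" for i
  proof -
    have "i \<in> dom (target b t0)"
      using that dom_target[OF t0(1)] by simp
    then obtain n where "target b t0 i = Some n"
      by blast
    then show ?thesis
      using target_le[OF t0(1)] by fastforce
  qed
  then have "lag b t0 \<le> card (active (real_inst b) t0) * C"
    unfolding lag_def deficit_def using sum_bounded_above[of "active (real_inst b) t0" _ C] by simp
  also have "\<dots> \<le> C * W"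
    using card_active_le[of t0 "acts b"] t0 by (simp add: real_inst_def mult.commute)
  finally show ?thesis .
qed

lemma gap_le:
  assumes "t \<le> Suc T"
  shows "gap b t \<le> real T"
proof -
  have "gap b t \<le> real (card {t0..<t}) * 1"
    unfolding gap_def using round_bounds(2) assms by (intro sum_bounded_above) auto
  also have "\<dots> \<le> real T"
    using assms t0 by simp
  finally show ?thesis .
qed

section \<open>The potential argument\<close>

lemma gap_Suc: "t0 \<le> t \<Longrightarrow> gap b (Suc t) = gap b t + loss b t"
  by (simp add: gap_def)

text \<open>With \<open>m\<close> missed units, exploring raises the potential by at most
  \<open>1 - m / \<epsilon>\<close> and exploiting by at most \<open>m\<close>. The weighted sum is
  \<open>\<epsilon> - \<epsilon> * m\<close>; the weight \<open>1 / \<epsilon>\<close> of the lag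
  lets repayments while exploring cover losses while exploiting.\<close>

lemma potential_step:
  assumes \<epsilon>: "0 < \<epsilon>" "\<epsilon> \<le> 1" and t: "t0 \<le> t" "t \<le> T"
    and b1: "b1 t" "\<And>s. s < t \<Longrightarrow> b1 s = b s" and b2: "\<not> b2 t" "\<And>s. s < t \<Longrightarrow> b2 s = b s"
  shows "\<epsilon> * (gap b1 (Suc t) + lag b1 (Suc t) / \<epsilon>) + (1 - \<epsilon>) * (gap b2 (Suc t) + lag b2 (Suc t) / \<epsilon>)
    \<le> gap b t + lag b t / \<epsilon> + \<epsilon>"
proof -
  have t': "t \<le> Suc T"
    using t by simp
  let ?P = "gap b t + lag b t / \<epsilon>" and ?m = "real (missed b t)"
  have "real (lag b1 (Suc t)) \<le> lag b t - ?m"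
    using round_bounds(3)[where b = b1, OF t b1(1)] lag_cong[OF t' b1(2) t(1)] missed_cong[OF t' b1(2) t(1)]
    by simp
  then have "lag b1 (Suc t) / \<epsilon> \<le> lag b t / \<epsilon> - ?m / \<epsilon>"
    using \<epsilon> by (simp add: divide_right_mono flip: diff_divide_distrib)
  then have "gap b1 (Suc t) + lag b1 (Suc t) / \<epsilon> \<le> ?P + 1 - ?m / \<epsilon>"
    using round_bounds(2)[where b = b1, OF t] gap_cong[OF t' b1(2)] gap_Suc[OF t(1), of b1] by simp
  then have 1: "\<epsilon> * (gap b1 (Suc t) + lag b1 (Suc t) / \<epsilon>) \<le> \<epsilon> * (?P + 1 - ?m / \<epsilon>)"
    using \<epsilon> by (intro mult_left_mono) auto
  have "lag b2 (Suc t) / \<epsilon> \<le> lag b t / \<epsilon>"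
    using round_bounds(4)[where b = b2, OF t b2(1)] lag_cong[OF t' b2(2) t(1)] \<epsilon>
    by (simp add: divide_right_mono)
  then have "gap b2 (Suc t) + lag b2 (Suc t) / \<epsilon> \<le> ?P + ?m"
    using round_bounds(5)[where b = b2, OF t b2(1)] missed_cong[OF t' b2(2) t(1)]
      gap_cong[OF t' b2(2)] gap_Suc[OF t(1), of b2] by simp
  then have 2: "(1 - \<epsilon>) * (gap b2 (Suc t) + lag b2 (Suc t) / \<epsilon>) \<le> (1 - \<epsilon>) * (?P + ?m)"
    using \<epsilon> by (intro mult_left_mono) auto
  have "\<epsilon> * (?P + 1 - ?m / \<epsilon>) + (1 - \<epsilon>) * (?P + ?m) = ?P + \<epsilon> - \<epsilon> * ?m"
    using \<epsilon> by (simp add: field_simps)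
  also have "\<dots> \<le> ?P + \<epsilon>"
    using \<epsilon> by simp
  finally show ?thesis
    using 1 2 by linarith
qed

text \<open>The minimum freezes the potential at the end of round \<open>tf\<close>: the seed
  distribution always has \<open>T\<close> flips, since it may not depend on
  \<open>tf\<close>.\<close>

definition potential :: "real \<Rightarrow> nat \<Rightarrow> bool list \<Rightarrow> real" where
  "potential \<epsilon> tf l = (let t = min (Suc tf) (t0 + length l); b = flips t0 l in gap b t + lag b t / \<epsilon>)"

lemma expected_potential_snoc:
  assumes \<epsilon>: "0 < \<epsilon>" "\<epsilon> \<le> 1" and tf: "t0 \<le> tf" "tf \<le> T"
  shows "\<epsilon> * potential \<epsilon> tf (l @ [True]) + (1 - \<epsilon>) * potential \<epsilon> tf (l @ [False]) \<le> potential \<epsilon> tf l + \<epsilon>"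
proof (cases "t0 + length l \<le> tf")
  case True
  then have min: "min (Suc tf) (t0 + length (l @ [x])) = Suc (t0 + length l)"
    "min (Suc tf) (t0 + length l) = t0 + length l" for x :: bool
    by auto
  have b: "flips t0 (l @ [True]) (t0 + length l)" "\<not> flips t0 (l @ [False]) (t0 + length l)"
    by (simp_all add: flips_snoc)
  have le: "t0 \<le> t0 + length l" "t0 + length l \<le> T"
    using True tf by auto
  show ?thesis
    unfolding potential_def Let_def min
    by (rule potential_step[OF \<epsilon> le]) (simp_all add: b flips_append)
next
  case False
  \<comment> \<open>The new flip belongs to a round after \<open>tf\<close>, so neither summand
    changes.\<close>
  have same: "potential \<epsilon> tf (l @ [x]) = potential \<epsilon> tf l" for x
  proof -
    have min: "min (Suc tf) (t0 + length (l @ [x])) = Suc tf" "min (Suc tf) (t0 + length l) = Suc tf"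
      using False by auto
    have agree: "flips t0 (l @ [x]) s = flips t0 l s" if "s < Suc tf" for s
      using that False by (intro flips_append) auto
    have t: "Suc tf \<le> Suc T" "t0 \<le> Suc tf"
      using tf by auto
    have "gap (flips t0 (l @ [x])) (Suc tf) = gap (flips t0 l) (Suc tf)"
      by (rule gap_cong[OF t(1) agree])
    moreover have "lag (flips t0 (l @ [x])) (Suc tf) = lag (flips t0 l) (Suc tf)"
      by (rule lag_cong[OF t(1) agree t(2)])
    ultimately show ?thesis
      unfolding potential_def Let_def min by simp
  qed
  show ?thesis
    unfolding same using \<epsilon> by (simp add: algebra_simps)
qed

lemma expected_gap_le:
  fixes \<epsilon> :: real
  assumes \<epsilon>: "0 < \<epsilon>" "\<epsilon> \<le> 1" and tf: "t0 \<le> tf" "tf \<le> T"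
  shows "measure_pmf.expectation (coin_flips \<epsilon> T) (\<lambda>l. gap (flips t0 l) (Suc tf))
    \<le> real C * real W / \<epsilon> + real T * \<epsilon>"
proof -
  let ?E = "measure_pmf.expectation (coin_flips \<epsilon> T)"
  have "?E (\<lambda>l. gap (flips t0 l) (Suc tf)) \<le> ?E (potential \<epsilon> tf)"
  proof (rule integral_mono_AE)
    show "AE l in measure_pmf (coin_flips \<epsilon> T). gap (flips t0 l) (Suc tf) \<le> potential \<epsilon> tf l"
    proof (rule AE_pmfI)
      fix l assume "l \<in> set_pmf (coin_flips \<epsilon> T)"
      \<comment> \<open>\<open>T\<close> flips starting at \<open>t0\<close> reach beyond round
        \<open>tf\<close>, because \<open>1 \<le> t0\<close> and \<open>tf \<le> T\<close>.\<close>
      then have "min (Suc tf) (t0 + length l) = Suc tf"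
        using tf t0 by (simp add: length_coin_flips)
      then show "gap (flips t0 l) (Suc tf) \<le> potential \<epsilon> tf l"
        using \<epsilon> by (simp add: potential_def Let_def)
    qed
  qed (simp_all add: integrable_measure_pmf_finite finite_coin_flips)
  also have "\<dots> \<le> potential \<epsilon> tf [] + real T * \<epsilon>"
    using \<epsilon> expected_potential_snoc[OF \<epsilon> tf] by (intro expectation_coin_flips_le) auto
  also have "potential \<epsilon> tf [] \<le> real C * real W / \<epsilon>"
  proof -
    have "real (lag b t0) \<le> real C * real W" for b
      using lag_init[of b] by (metis of_nat_le_iff of_nat_mult)
    then show ?thesis
      using tf \<epsilon> by (simp add: potential_def gap_def min_def divide_right_mono)
  qed
  finally show ?thesis
    by simp
qed

section \<open>Link to the definition of chasability and choice of the exploration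
  probability\<close>

lemma chase_gap_eq: "chase_gap (chase_oracle \<gamma> t0 s0 b) adv \<gamma> t0 s0 T tf = gap b (Suc tf)"
  by (simp add: chase_gap_def Let_def gap_def loss_def target_def real_inst_def acts_def
      sum_subtractf atLeastLessThanSuc_atLeastAtMost)

text \<open>The inventory that the oracle simulates is the one its posted prices really produce, so
  feasibility carries over.\<close>

lemma oracle_state_eq:
  assumes "t0 \<le> t" "t \<le> T"
  shows "oracle_state (real_inst b) (acts b) t0 s0 t = chaser b t"
proof -
  have "orc_st (real_inst b) (acts b) t0 s0 n = chaser b (t0 + n)" if "t0 + n \<le> T" for n
    using that
  proof (induction n)
    case 0
    then show ?case
      by (simp add: chaser_def)
  next
    case (Suc n)
    then show ?case
      using chaser_Suc[of "t0 + n" b] by simp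
  qed
  from this[of "t - t0"] show ?thesis
    using assms by (simp add: oracle_state_def)
qed

lemma oracle_feasible_chase: "oracle_feasible (chase_oracle \<gamma> t0 s0 b) adv t0 s0 T"
  using round_bounds(1)[where b = b] oracle_state_eq[where b = b]
  by (simp add: oracle_feasible_def Let_def real_inst_def acts_def)

end

text \<open>The root minimises \<open>C * W / \<epsilon> + T * \<epsilon>\<close>, but is a
  probability only if \<open>C * W \<le> T\<close>.\<close>

definition explore_prob :: "nat \<Rightarrow> nat \<Rightarrow> nat \<Rightarrow> real" where
  "explore_prob C W T = (if 0 < C * W \<and> C * W \<le> T then sqrt (C * W / T) else 1)"

text \<open>At this probability both terms equal the square root of \<open>C * W * T\<close>, hence
  the factor 2. If \<open>C * W > T\<close>, the trivial loss bound \<open>T\<close> is already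
  below that root.\<close>

lemma (in chase) expected_gap_le_sqrt:
  assumes tf: "t0 \<le> tf" "tf \<le> T"
  shows "measure_pmf.expectation (coin_flips (explore_prob C W T) T) (\<lambda>l. gap (flips t0 l) (Suc tf))
    \<le> 2 * sqrt (real C * real W * real T)"
proof (cases "C * W \<le> T")
  case True
  let ?c = "real C * real W" and ?T = "real T"
  have c: "0 < ?c" "?c \<le> ?T"
    using capacity_width_pos True by (simp_all flip: of_nat_mult)
  then have \<epsilon>: "explore_prob C W T = sqrt ?c / sqrt ?T"
    using capacity_width_pos True by (simp add: explore_prob_def real_sqrt_divide)
  have "0 < sqrt ?c / sqrt ?T" "sqrt ?c / sqrt ?T \<le> 1"
    using c by auto
  from expected_gap_le[OF this tf] have
    "measure_pmf.expectation (coin_flips (explore_prob C W T) T) (\<lambda>l. gap (flips t0 l) (Suc tf))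
      \<le> ?c / (sqrt ?c / sqrt ?T) + ?T * (sqrt ?c / sqrt ?T)"
    by (simp add: \<epsilon>)
  also have "?c / (sqrt ?c / sqrt ?T) = ?c / sqrt ?c * sqrt ?T"
    by simp
  also have "?c / sqrt ?c = sqrt ?c"
    by (rule real_div_sqrt) (use c in simp)
  also have "?T * (sqrt ?c / sqrt ?T) = sqrt ?c * (?T / sqrt ?T)"
    by simp
  also have "?T / sqrt ?T = sqrt ?T"
    by (rule real_div_sqrt) (use c in simp)
  finally show ?thesis
    by (simp add: real_sqrt_mult mult_ac)
next
  case False
  let ?p = "coin_flips (explore_prob C W T) T"
  have "measure_pmf.expectation ?p (\<lambda>l. gap (flips t0 l) (Suc tf)) \<le> measure_pmf.expectation ?p (\<lambda>l. real T)"
    by (rule integral_mono) (use gap_le tf in \<open>simp_all add: integrable_measure_pmf_finite finite_coin_flips\<close>)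
  also have "\<dots> = sqrt (real T * real T)"
    by simp
  also have "\<dots> \<le> sqrt (real C * real W * real T)"
  proof (intro real_sqrt_le_mono mult_right_mono)
    show "real T \<le> real C * real W"
      using False by (simp flip: of_nat_mult)
  qed simp
  also have "\<dots> \<le> 2 * sqrt (real C * real W * real T)"
    by simp
  finally show ?thesis .
qed

theorem theorem1:
  shows "\<exists>K::real. \<forall>C W T::nat. kdemand_chasable C W T (K * sqrt (real C * real W * real T))"
proof (intro exI allI)
  fix C W T :: nat
  show "kdemand_chasable C W T (2 * sqrt (real C * real W * real T))"
    unfolding kdemand_chasable_def
  proof (intro allI impI)
    fix \<gamma> :: "state \<Rightarrow> price" and t0 :: nat and s0 :: state
    assume A: "pricing_policy C \<gamma> \<and> 1 \<le> t0 \<and> t0 \<le> T \<and> inventory_vector C s0"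
    define p where "p = coin_flips (explore_prob C W T) T"
    \<comment> \<open>Seeds must be natural numbers, so flip lists are encoded by
      \<open>to_nat\<close> and decoded here. Distribution and strategies are fixed before the
      adversary is.\<close>
    define orc where "orc = (\<lambda>\<omega>::nat. chase_oracle \<gamma> t0 s0 (flips t0 (from_nat \<omega>)))"
    have "(\<forall>\<omega>. oracle_feasible (orc \<omega>) adv t0 s0 T) \<and>
        (\<forall>tf\<in>{t0..T}.
          integrable (measure_pmf (map_pmf to_nat p)) (\<lambda>\<omega>. chase_gap (orc \<omega>) adv \<gamma> t0 s0 T tf) \<and>
          measure_pmf.expectation (map_pmf to_nat p) (\<lambda>\<omega>. chase_gap (orc \<omega>) adv \<gamma> t0 s0 T tf)
            \<le> 2 * sqrt (real C * real W * real T))"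
      if "admissible_adversary C W T t0 s0 adv" for adv
    proof -
      interpret chase C W T t0 \<gamma> s0 adv
        using A that by unfold_locales auto
      have "integrable (measure_pmf (map_pmf to_nat p)) f" for f :: "nat \<Rightarrow> real"
        by (rule integrable_measure_pmf_finite) (simp add: p_def finite_coin_flips)
      moreover have "measure_pmf.expectation (map_pmf to_nat p) (\<lambda>\<omega>. chase_gap (orc \<omega>) adv \<gamma> t0 s0 T tf)
          \<le> 2 * sqrt (real C * real W * real T)" if "tf \<in> {t0..T}" for tf
        using expected_gap_le_sqrt[of tf] that by (simp add: orc_def p_def chase_gap_eq)
      moreover have "oracle_feasible (orc \<omega>) adv t0 s0 T" for \<omega>
        by (simp add: orc_def oracle_feasible_chase)
      ultimately show ?thesis
        by blast
    qed
    then show "\<exists>(\<mu>::nat pmf) orc. \<forall>adv. admissible_adversary C W T t0 s0 adv \<longrightarrow>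
        (\<forall>\<omega>\<in>set_pmf \<mu>. oracle_feasible (orc \<omega>) adv t0 s0 T) \<and>
        (\<forall>tf\<in>{t0..T}.
          integrable (measure_pmf \<mu>) (\<lambda>\<omega>. chase_gap (orc \<omega>) adv \<gamma> t0 s0 T tf) \<and>
          measure_pmf.expectation \<mu> (\<lambda>\<omega>. chase_gap (orc \<omega>) adv \<gamma> t0 s0 T tf)
            \<le> 2 * sqrt (real C * real W * real T))"
      by blast
  qed
qed

end
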